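(* Let $\widehat\Theta(Y)$ be an estimator with values in $T$. Assume there are a penalty $\Omega:T\to\mathbb R$ and nonnegative integrable random variables $\varepsilon_{\rm opt},\varepsilon_{\rm pen}$, measurable under the joint law of $(\Theta,Z)$, such that \[ \|Y-v_{\widehat\Theta}\|^2+\Omega(\widehat\Theta)\le\|Y-v_\Theta\|^2+\Omega(\Theta)+\varepsilon_{\rm opt},\qquad \Omega(\widehat\Theta)\ge\Omega(\Theta)-\varepsilon_{\rm pen}, \] and put $\varepsilon_{\rm cmp}:=\varepsilon_{\rm opt}+\varepsilon_{\rm pen}$. If, for some $c\in(0,1)$ and $\Delta>0$, \[ \mathcal I_{\pi,m}+\log2\le(1-c)\log\frac1{\rho_{\Delta,Q_{\tau,m}}(\widehat\Theta)}, \] then \[ \mathbb E_{\Theta,Y}\,d(\Theta,\widehat\Theta(Y))\ge c\Delta, \] and, for the Gaussian process $X_t:=\langle Z,v_t\rangle$ built from the same Gaussian vector $Z$, \[ \mathbb E_{\Theta,Z}\bigl[X_{\widehat\Theta}-X_\Theta\bigr]\ge\frac{c^2\Delta^2-\mathbb E_{\Theta,Z}\varepsilon_{\rm cmp}}{2\tau}. \] In particular, if $\mathbb E\varepsilon_{\rm cmp}\le c^2\Delta^2/2$, the right-hand side is at least $c^2\Delta^2/(4\tau)$. Moreover: (a) with $\bar v_\pi:=\int_Tv_t\,\pi(dt)$, the choice $m=\bar v_\pi$ gives $\mathcal I_{\pi,\bar v_\pi}=\mathsf V_\pi/(4\tau^2)$, where $\mathsf V_\pi:=\iint d(s,t)^2\,\pi(ds)\pi(dt)$.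 (b) The ordinary nearest-neighbor decoder $\widehat\Theta(Y)\in\arg\min_{a\in T}\|Y-v_a\|^2$ satisfies the comparison condition with $\Omega\equiv0$ and $\varepsilon_{\rm opt}=\varepsilon_{\rm pen}=0$. (c) The norm-regularized nearest-neighbor rule $\widehat\Theta_\lambda(Y)\in\arg\min_{a\in T}\{\|Y-v_a\|^2+\lambda\|v_a\|^2\}$, $\lambda\ge0$, satisfies the comparison condition (with $\Omega(t)=\lambda\|v_t\|^2$) with $\varepsilon_{\rm opt}=\varepsilon_{\rm pen}=0$ whenever the realized outputs have norm at least that of the true parameter, i.e. $\|v_{\widehat\Theta_\lambda}\|\ge\|v_\Theta\|$ almost surely.
   Context: $T$ is a finite set, $v:T\to\mathcal H$ is an embedding into a finite-dimensional Hilbert space $\mathcal H$, and $d(s,t):=\|v_s-v_t\|_{\mathcal H}$. $\pi$ is a probability measure on $T$ and $\tau>0$. The Gaussian location experiment is \[ Y=v_\Theta+\tau Z,\qquad\Theta\sim\pi,\qquad Z\sim N(0,I_{\mathcal H}), \] with $\Theta$ and $Z$ independent. $m\in\mathcal H$ is any reference center, and \[ Q_{\tau,m}:=N(m,\tau^2I_{\mathcal H}),\qquad \mathcal I_{\pi,m}:=\frac1{2\tau^2}\int_T\|v_t-m\|^2\,\pi(dt). \] For an estimator $\widehat\Theta$ (measurable map $\mathcal H\to T$), $\Delta>0$ and a law $Q$ on $\mathcal H$, \[ \rho_{\Delta,Q}(\widehat\Theta):=\mathbb P\{d(t,\widehat\Theta(Y'))<\Delta\},\qquad t\sim\pi,\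 Y'\sim Q\ \text{independent} \] (with $\log(1/0)=+\infty$). In $X_{\widehat\Theta}$ and $v_{\widehat\Theta}$, $\widehat\Theta=\widehat\Theta(Y)=\widehat\Theta(v_\Theta+\tau Z)$. *)

theory Defs
  imports "HOL-Probability.Probability"
begin

text \<open>The law \<open>N(m, \<sigma>\<^sup>2 I)\<close>: independent coordinates \<open>N(m \<bullet> b, \<sigma>\<^sup>2)\<close> in the orthonormal basis
  \<^const>\<open>Basis\<close>; the second argument is the standard deviation.\<close>

definition gaussian :: "'a::euclidean_space \<Rightarrow> real \<Rightarrow> 'a measure" where
  "gaussian m \<sigma> = density lborel (\<lambda>y. ennreal (\<Prod>b\<in>Basis. normal_density (m \<bullet> b) \<sigma> (y \<bullet> b)))"

text \<open>The law of \<open>(\<Theta>, Z)\<close> with \<open>\<Theta> \<sim> \<pi>\<close> and \<open>Z \<sim> N(0, I)\<close> independent. Random variables measurable under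
  this law are functions of the pair \<open>(\<theta>, z)\<close>, and all expectations are integrals against it.\<close>

definition joint_law :: "'t measure \<Rightarrow> ('t \<times> 'a::euclidean_space) measure" where
  "joint_law \<pi> = \<pi> \<Otimes>\<^sub>M gaussian 0 1"

definition obs :: "('t \<Rightarrow> 'a::euclidean_space) \<Rightarrow> real \<Rightarrow> 't \<Rightarrow> 'a \<Rightarrow> 'a" where
  "obs v \<tau> \<theta> z = v \<theta> + \<tau> *\<^sub>R z"

definition emb_dist :: "('t \<Rightarrow> 'a::euclidean_space) \<Rightarrow> 't \<Rightarrow> 't \<Rightarrow> real" where
  "emb_dist v s t = norm (v s - v t)"

definition info :: "('t \<Rightarrow> 'a::euclidean_space) \<Rightarrow> real \<Rightarrow> 't measure \<Rightarrow> 'a \<Rightarrow> real" where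
  "info v \<tau> \<pi> m = 1 / (2 * \<tau>\<^sup>2) * (\<integral>t. (norm (v t - m))\<^sup>2 \<partial>\<pi>)"

definition barycenter :: "('t \<Rightarrow> 'a::euclidean_space) \<Rightarrow> 't measure \<Rightarrow> 'a" where
  "barycenter v \<pi> = (\<integral>t. v t \<partial>\<pi>)"

definition pair_variance :: "('t \<Rightarrow> 'a::euclidean_space) \<Rightarrow> 't measure \<Rightarrow> real" where
  "pair_variance v \<pi> = (\<integral>s. (\<integral>t. (emb_dist v s t)\<^sup>2 \<partial>\<pi>) \<partial>\<pi>)"

definition estimator :: "'t set \<Rightarrow> ('a::euclidean_space \<Rightarrow> 't) \<Rightarrow> bool" where
  "estimator T est \<longleftrightarrow> est \<in> borel \<rightarrow>\<^sub>M count_space T"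

definition rho :: "('t \<Rightarrow> 'a::euclidean_space) \<Rightarrow> 't measure \<Rightarrow> real \<Rightarrow> 'a measure \<Rightarrow> ('a \<Rightarrow> 't) \<Rightarrow> real" where
  "rho v \<pi> \<Delta> Q est =
     measure (\<pi> \<Otimes>\<^sub>M Q) {(t, y) \<in> space (\<pi> \<Otimes>\<^sub>M Q). emb_dist v t (est y) < \<Delta>}"

definition log_recip :: "real \<Rightarrow> ereal" where
  "log_recip p = (if p = 0 then \<infinity> else ereal (ln (1 / p)))"

text \<open>Inequalities between random variables are understood almost surely.\<close>

definition comparison_condition ::
  "('t \<Rightarrow> 'a::euclidean_space) \<Rightarrow> real \<Rightarrow> 't measure \<Rightarrow> ('a \<Rightarrow> 't) \<Rightarrow> ('t \<Rightarrow> real) \<Rightarrow>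
   ('t \<times> 'a \<Rightarrow> real) \<Rightarrow> ('t \<times> 'a \<Rightarrow> real) \<Rightarrow> bool" where
  "comparison_condition v \<tau> \<pi> est \<Omega> \<epsilon>\<^sub>o\<^sub>p\<^sub>t \<epsilon>\<^sub>p\<^sub>e\<^sub>n \<longleftrightarrow>
     integrable (joint_law \<pi>) \<epsilon>\<^sub>o\<^sub>p\<^sub>t \<and> integrable (joint_law \<pi>) \<epsilon>\<^sub>p\<^sub>e\<^sub>n \<and>
     (AE (\<theta>, z) in joint_law \<pi>. 0 \<le> \<epsilon>\<^sub>o\<^sub>p\<^sub>t (\<theta>, z) \<and> 0 \<le> \<epsilon>\<^sub>p\<^sub>e\<^sub>n (\<theta>, z)) \<and>
     (AE (\<theta>, z) in joint_law \<pi>.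
        (norm (obs v \<tau> \<theta> z - v (est (obs v \<tau> \<theta> z))))\<^sup>2 + \<Omega> (est (obs v \<tau> \<theta> z))
          \<le> (norm (obs v \<tau> \<theta> z - v \<theta>))\<^sup>2 + \<Omega> \<theta> + \<epsilon>\<^sub>o\<^sub>p\<^sub>t (\<theta>, z)) \<and>
     (AE (\<theta>, z) in joint_law \<pi>. \<Omega> (est (obs v \<tau> \<theta> z)) \<ge> \<Omega> \<theta> - \<epsilon>\<^sub>p\<^sub>e\<^sub>n (\<theta>, z))"

text \<open>\<open>d(\<Theta>, est(Y))\<close> and \<open>X\<^bsub>est(Y)\<^esub> - X\<^sub>\<Theta>\<close>, where \<open>X\<^sub>t = \<langle>Z, v\<^sub>t\<rangle>\<close>, as functions of \<open>(\<theta>, z)\<close>.\<close>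

definition est_error :: "('t \<Rightarrow> 'a::euclidean_space) \<Rightarrow> real \<Rightarrow> ('a \<Rightarrow> 't) \<Rightarrow> 't \<times> 'a \<Rightarrow> real" where
  "est_error v \<tau> est = (\<lambda>(\<theta>, z). emb_dist v \<theta> (est (obs v \<tau> \<theta> z)))"

definition process_gain :: "('t \<Rightarrow> 'a::euclidean_space) \<Rightarrow> real \<Rightarrow> ('a \<Rightarrow> 't) \<Rightarrow> 't \<times> 'a \<Rightarrow> real" where
  "process_gain v \<tau> est = (\<lambda>(\<theta>, z). z \<bullet> v (est (obs v \<tau> \<theta> z)) - z \<bullet> v \<theta>)"

end

theory Submission
  imports Defs
begin

text \<open>The error bound is a Fano-type argument in the variational form of Donsker and Varadhan. Let \<open>L\<close> be the
  log-likelihood ratio of the law of \<open>(\<Theta>, Y)\<close> against \<open>\<pi> \<otimes> N(m, \<tau>\<^sup>2 I)\<close>. It is affine in the noise, so its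
  mean is the information term. For the event \<open>H = {d(\<Theta>, est(Y)) < \<Delta>}\<close> and any \<open>a\<close> with \<open>exp a * \<rho> \<le> 1\<close>,
  the exponential of \<open>a 1\<^sub>H - L - ln 2\<close> has expectation at most \<open>(1 + exp a * \<rho>) / 2 \<le> 1\<close>, and
  \<open>1 + x \<le> exp x\<close> yields \<open>a P(H) \<le> info + ln 2\<close>. Taking \<open>a = (info + ln 2) / (1 - c)\<close> gives
  \<open>P(H) \<le> 1 - c\<close>, also when \<open>\<rho> = 0\<close>. Expanding the square in the comparison condition gives
  \<open>d(\<Theta>, est(Y))\<^sup>2 - \<epsilon>\<^sub>c\<^sub>m\<^sub>p \<le> 2 \<tau> (X\<^bsub>est(Y)\<^esub> - X\<^sub>\<Theta>)\<close>, and the process bound follows by Jensen.\<close>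

section \<open>Gaussian measures: total mass, change of center, first moments\<close>

lemma sets_gaussian [measurable_cong, simp]: "sets (gaussian m \<sigma>) = sets borel"
  by (simp add: gaussian_def)

lemma space_gaussian [simp]: "space (gaussian m \<sigma>) = UNIV"
  by (simp add: gaussian_def)

lemma nn_integral_gaussian:
  fixes m :: "'a::euclidean_space"
  assumes [measurable]: "F \<in> borel_measurable borel"
  shows "(\<integral>\<^sup>+y. F y \<partial>gaussian m \<sigma>) =
    (\<integral>\<^sup>+y. ennreal (\<Prod>b\<in>Basis. normal_density (m \<bullet> b) \<sigma> (y \<bullet> b)) * F y \<partial>lborel)"
  unfolding gaussian_def by (intro nn_integral_density) measurable

lemma prob_space_gaussian:
  fixes m :: "'a::euclidean_space"
  assumes "\<sigma> > 0"
  shows "prob_space (gaussian m \<sigma>)"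
proof
  have "emeasure (gaussian m \<sigma>) (space (gaussian m \<sigma>)) =
      (\<integral>\<^sup>+y. (\<Prod>b\<in>(Basis :: 'a set). ennreal (normal_density (m \<bullet> b) \<sigma> (y \<bullet> b))) \<partial>lborel)"
    using nn_integral_gaussian[of "\<lambda>_. 1" m \<sigma>]
    by (simp add: prod_ennreal)
  also have "\<dots> = (\<Prod>b\<in>(Basis :: 'a set). (\<integral>\<^sup>+x. ennreal (normal_density (m \<bullet> b) \<sigma> x) \<partial>lborel))"
    by (intro nn_integral_lborel_prod) auto
  also have "\<dots> = 1"
    using assms by (simp add: nn_integral_eq_integral)
  finally show "emeasure (gaussian m \<sigma>) (space (gaussian m \<sigma>)) = 1" .
qed

text \<open>Completing the square at y = a + \<sigma> z: with w = a - m, the exponent of the density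
  at y splits into that of the standard density at z and a remainder affine in z. The factor
  \<open>\<bar>\<sigma>\<bar> ^ DIM('a)\<close> is the Jacobian of the substitution. The sign of
  \<sigma> is left open so that \<sigma> = -1 gives a reflection.\<close>

lemma gaussian_density_affine:
  fixes a m z :: "'a::euclidean_space"
  assumes "\<sigma> \<noteq> 0"
  shows "\<bar>\<sigma>\<bar> ^ DIM('a) * (\<Prod>b\<in>Basis. normal_density (m \<bullet> b) \<sigma> ((a + \<sigma> *\<^sub>R z) \<bullet> b)) =
    (\<Prod>b\<in>Basis. normal_density 0 1 (z \<bullet> b)) *
      exp (- ((norm (a - m))\<^sup>2 + 2 * \<sigma> * ((a - m) \<bullet> z)) / (2 * \<sigma>\<^sup>2))"
proof -
  let ?w = "a - m"
  have "\<bar>\<sigma>\<bar> * normal_density (m \<bullet> b) \<sigma> ((a + \<sigma> *\<^sub>R z) \<bullet> b) =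
      normal_density 0 1 (z \<bullet> b) *
        exp (- ((?w \<bullet> b) * (?w \<bullet> b) + 2 * \<sigma> * ((?w \<bullet> b) * (z \<bullet> b))) / (2 * \<sigma>\<^sup>2))" for b
  proof -
    have "(a + \<sigma> *\<^sub>R z) \<bullet> b - m \<bullet> b = ?w \<bullet> b + \<sigma> * (z \<bullet> b)"
      by (simp add: inner_simps)
    \<comment> \<open>Here p and q stand for the coordinates of a - m and of z along
      \<open>b\<close>.\<close>
    moreover have "- (p + \<sigma> * q)\<^sup>2 / (2 * \<sigma>\<^sup>2) = - q\<^sup>2 / 2 + - (p * p + 2 * \<sigma> * (p * q)) / (2 * \<sigma>\<^sup>2)" for p q
      using assms by (simp add: field_simps power2_eq_square)
    ultimately show ?thesis
      using assms by (simp add: normal_density_def real_sqrt_mult exp_add[symmetric])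
  qed
  then have "(\<Prod>b\<in>(Basis :: 'a set). \<bar>\<sigma>\<bar> * normal_density (m \<bullet> b) \<sigma> ((a + \<sigma> *\<^sub>R z) \<bullet> b)) =
      (\<Prod>b\<in>Basis. normal_density 0 1 (z \<bullet> b)) *
      exp (\<Sum>b\<in>Basis. - ((?w \<bullet> b) * (?w \<bullet> b) + 2 * \<sigma> * ((?w \<bullet> b) * (z \<bullet> b))) / (2 * \<sigma>\<^sup>2))"
    by (simp only: prod.distrib exp_sum[OF finite_Basis])
  moreover have "(\<Sum>b\<in>Basis. - ((?w \<bullet> b) * (?w \<bullet> b) + 2 * \<sigma> * ((?w \<bullet> b) * (z \<bullet> b))) / (2 * \<sigma>\<^sup>2)) =
      - ((norm ?w)\<^sup>2 + 2 * \<sigma> * (?w \<bullet> z)) / (2 * \<sigma>\<^sup>2)"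
    unfolding power2_norm_eq_inner euclidean_inner[of ?w ?w] euclidean_inner[of ?w z]
    by (simp only: sum_divide_distrib[symmetric] sum_negf sum.distrib sum_distrib_left)
  ultimately show ?thesis
    by (simp add: prod.distrib)
qed

text \<open>A finite-dimensional Cameron-Martin formula. The exponential weight is the likelihood
  ratio of the laws with centers m and a, evaluated at a + \<sigma> z; it is 1 when a = m.\<close>

lemma nn_integral_gaussian_shift:
  fixes a m :: "'a::euclidean_space"
  assumes "\<sigma> \<noteq> 0" and [measurable]: "F \<in> borel_measurable borel"
  shows "(\<integral>\<^sup>+y. F y \<partial>gaussian m \<sigma>) =
    (\<integral>\<^sup>+z. F (a + \<sigma> *\<^sub>R z) *
      ennreal (exp (- ((norm (a - m))\<^sup>2 + 2 * \<sigma> * ((a - m) \<bullet> z)) / (2 * \<sigma>\<^sup>2))) \<partial>gaussian 0 1)"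
proof -
  let ?p = "\<lambda>y::'a. \<Prod>b\<in>Basis. normal_density (m \<bullet> b) \<sigma> (y \<bullet> b)"
  let ?q = "\<lambda>z::'a. \<Prod>b\<in>Basis. normal_density 0 1 (z \<bullet> b)"
  let ?e = "\<lambda>z. exp (- ((norm (a - m))\<^sup>2 + 2 * \<sigma> * ((a - m) \<bullet> z)) / (2 * \<sigma>\<^sup>2))"
  have "(\<integral>\<^sup>+y. F y \<partial>gaussian m \<sigma>) = (\<integral>\<^sup>+y. ennreal (?p y) * F y \<partial>lborel)"
    by (simp add: nn_integral_gaussian)
  \<comment> \<open>Substitution y = a + \<sigma> z in the Lebesgue integral.\<close>
  also have "\<dots> = (\<integral>\<^sup>+z. ennreal (\<bar>\<sigma>\<bar> ^ DIM('a)) * (ennreal (?p (a + \<sigma> *\<^sub>R z)) * F (a + \<sigma> *\<^sub>R z)) \<partial>lborel)"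
    by (subst lborel_affine[OF assms(1), of a])
       (simp add: nn_integral_density nn_integral_distr)
  also have "\<dots> = (\<integral>\<^sup>+z. ennreal (?q z) * (F (a + \<sigma> *\<^sub>R z) * ennreal (?e z)) \<partial>lborel)"
  proof (intro nn_integral_cong)
    fix z :: 'a
    have "ennreal (\<bar>\<sigma>\<bar> ^ DIM('a)) * ennreal (?p (a + \<sigma> *\<^sub>R z)) = ennreal (?q z) * ennreal (?e z)"
      using gaussian_density_affine[OF assms(1), of m a z]
      by (subst (1 2) ennreal_mult[symmetric]) (auto intro!: prod_nonneg)
    then show "ennreal (\<bar>\<sigma>\<bar> ^ DIM('a)) * (ennreal (?p (a + \<sigma> *\<^sub>R z)) * F (a + \<sigma> *\<^sub>R z)) =
        ennreal (?q z) * (F (a + \<sigma> *\<^sub>R z) * ennreal (?e z))"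
      by (simp add: mult.assoc[symmetric] mult.commute[of _ "F (a + \<sigma> *\<^sub>R z)"]) (simp add: mult.assoc)
  qed
  also have "\<dots> = (\<integral>\<^sup>+z. F (a + \<sigma> *\<^sub>R z) * ennreal (?e z) \<partial>gaussian 0 1)"
    by (subst nn_integral_gaussian) simp_all
  finally show ?thesis .
qed

text \<open>The density depends on \<sigma> only through its square, so \<open>gaussian 0 1\<close>
  and \<open>gaussian 0 (-1)\<close> coincide. The change of variables with a = m = 0 and \<sigma> =
  -1 has weight 1 and is the reflection.\<close>

lemma distr_gaussian_uminus: "distr (gaussian (0::'a::euclidean_space) 1) borel uminus = gaussian 0 1"
proof (rule measure_eqI)
  fix A :: "'a set"
  assume "A \<in> sets (distr (gaussian 0 1) borel uminus)"
  then have A [measurable]: "A \<in> sets borel"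
    by simp
  have "gaussian (0::'a) 1 = gaussian 0 (-1)"
    by (simp add: gaussian_def normal_density_def)
  then have "emeasure (gaussian 0 1) A = (\<integral>\<^sup>+y. indicator A y \<partial>gaussian 0 (-1))"
    by simp
  also have "\<dots> = (\<integral>\<^sup>+z. indicator A (- z) \<partial>gaussian 0 1)"
    by (subst nn_integral_gaussian_shift[where a = 0]) auto
  also have "\<dots> = emeasure (distr (gaussian 0 1) borel uminus) A"
    by (subst nn_integral_distr[of uminus _ borel "indicator A", symmetric]) auto
  finally show "emeasure (distr (gaussian 0 1) borel uminus) A = emeasure (gaussian 0 1) A"
    by simp
qed simp

text \<open>By linearity it suffices to treat basis vectors, where the integral factorizes over the
  coordinates into one first absolute moment and otherwise total masses.\<close>

lemma integrable_gaussian_inner: "integrable (gaussian (0::'a::euclidean_space) 1) (\<lambda>z. z \<bullet> u)"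
proof -
  have basis: "integrable (gaussian (0::'a) 1) (\<lambda>z. z \<bullet> b)" if b: "b \<in> Basis" for b
  proof (rule integrableI_bounded)
    \<comment> \<open>The factor \<bar>x\<bar> is attached to coordinate \<open>b\<close> alone,
      which puts the integrand in product form.\<close>
    let ?f = "\<lambda>c x. (if c = b then ennreal \<bar>x\<bar> else 1) * ennreal (normal_density 0 1 x)"
    have "(\<integral>\<^sup>+z. ennreal (norm (z \<bullet> b)) \<partial>gaussian (0::'a) 1) =
        (\<integral>\<^sup>+z. (\<Prod>c\<in>Basis. ?f c (z \<bullet> c)) \<partial>lborel)"
      using b by (subst nn_integral_gaussian)
        (auto intro!: nn_integral_cong simp: prod.distrib prod.If_cases prod_ennreal mult.commute
          Int_absorb1 prod.delta)
    also have "\<dots> = (\<Prod>c\<in>(Basis :: 'a set). (\<integral>\<^sup>+x. ?f c x \<partial>lborel))"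
      by (intro nn_integral_lborel_prod) auto
    also have "\<dots> < \<infinity>"
    proof -
      have "(\<integral>\<^sup>+x. ?f c x \<partial>lborel) < \<infinity>" for c
      proof (cases "c = b")
        case True
        have "integrable lborel (\<lambda>x. normal_density 0 1 x * \<bar>x\<bar>)"
          using integrable_normal_moment_abs[of 1 0 1] by simp
        then show ?thesis
          using True by (simp add: integrable_iff_bounded abs_mult ennreal_mult' mult.commute)
      next
        case False
        then show ?thesis
          by (simp add: nn_integral_eq_integral)
      qed
      then show ?thesis
        by (auto simp: ennreal_prod_eq_top less_top[symmetric])
    qed
    finally show "(\<integral>\<^sup>+z. ennreal (norm (z \<bullet> b)) \<partial>gaussian (0::'a) 1) < \<infinity>" .
  qed measurable
  have "(\<lambda>z::'a. z \<bullet> u) = (\<lambda>z. \<Sum>b\<in>Basis. (z \<bullet> b) * (u \<bullet> b))"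
    by (rule ext) (rule euclidean_inner)
  then show ?thesis
    using basis by simp
qed

lemma integrable_gaussian_norm: "integrable (gaussian (0::'a::euclidean_space) 1) norm"
proof (rule Bochner_Integration.integrable_bound)
  show "integrable (gaussian (0::'a) 1) (\<lambda>z. \<Sum>b\<in>Basis. \<bar>z \<bullet> b\<bar>)"
    using integrable_gaussian_inner by (intro Bochner_Integration.integrable_sum integrable_abs)
qed (auto intro: order_trans[OF norm_le_l1])

text \<open>By reflection symmetry the integral equals its own negative.\<close>

lemma integral_gaussian_inner: "(\<integral>z. z \<bullet> u \<partial>gaussian (0::'a::euclidean_space) 1) = 0"
proof -
  have "(\<integral>z. z \<bullet> u \<partial>gaussian (0::'a) 1) = (\<integral>z. (- z) \<bullet> u \<partial>gaussian 0 1)"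
    by (subst (1) distr_gaussian_uminus[symmetric], subst integral_distr) auto
  then show ?thesis
    by simp
qed

section \<open>The location experiment: measurability, integrability and the information
  term\<close>

locale gaussian_location =
  fixes T :: "'t set"
    and v :: "'t \<Rightarrow> 'a::euclidean_space"
    and \<pi> :: "'t measure"
    and \<tau> :: real
  assumes finite_T: "finite T"
    and prob_prior: "prob_space \<pi>"
    and sets_prior: "sets \<pi> = Pow T"
    and noise_pos: "\<tau> > 0"
begin

sublocale prior: prob_space \<pi>
  by (rule prob_prior)

sublocale noise: prob_space "gaussian (0::'a) 1"
  by (rule prob_space_gaussian) simp

sublocale prior_noise: pair_prob_space \<pi> "gaussian (0::'a) 1" ..

sublocale joint: prob_space "joint_law \<pi> :: ('t \<times> 'a) measure"
  unfolding joint_law_def by (rule prior_noise.prob_space_axioms)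

lemma space_prior [simp]: "space \<pi> = T"
  using sets_eq_imp_space_eq[of \<pi> "count_space T"] by (simp add: sets_prior)

lemma space_joint [simp]: "space (joint_law \<pi> :: ('t \<times> 'a) measure) = T \<times> UNIV"
  by (simp add: joint_law_def space_pair_measure)

lemma sets_prior_count_space [measurable_cong]: "sets \<pi> = sets (count_space T)"
  by (simp add: sets_prior)

lemma sets_joint [measurable_cong]:
  "sets (joint_law \<pi> :: ('t \<times> 'a) measure) = sets (count_space T \<Otimes>\<^sub>M borel)"
  unfolding joint_law_def by (intro sets_pair_measure_cong) (simp_all add: sets_prior)

lemma measurable_count_space_borel [measurable]:
  fixes w :: "'t \<Rightarrow> 'b::topological_space"
  shows "w \<in> borel_measurable (count_space T)"
  by simp

text \<open>A function on the finite set \<open>T\<close> is bounded, and the discrete sigma-algebra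
  makes it measurable.\<close>

lemma integrable_prior [simp]:
  fixes w :: "'t \<Rightarrow> 'b::{banach, second_countable_topology}"
  shows "integrable \<pi> w"
proof (rule prior.integrable_const_bound)
  show "AE t in \<pi>. norm (w t) \<le> Max ((\<lambda>t. norm (w t)) ` T)"
    using finite_T by (intro AE_I2) simp
qed measurable

lemma distr_joint_fst: "distr (joint_law \<pi> :: ('t \<times> 'a) measure) \<pi> fst = \<pi>"
  unfolding joint_law_def by (rule noise.distr_pair_fst)

lemma integral_joint_fst:
  fixes w :: "'t \<Rightarrow> real"
  shows "integrable (joint_law \<pi> :: ('t \<times> 'a) measure) (\<lambda>\<omega>. w (fst \<omega>))"
    and "(\<integral>\<omega>. w (fst \<omega>) \<partial>(joint_law \<pi> :: ('t \<times> 'a) measure)) = (\<integral>t. w t \<partial>\<pi>)"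
proof -
  have fst: "fst \<in> (joint_law \<pi> :: ('t \<times> 'a) measure) \<rightarrow>\<^sub>M \<pi>"
    unfolding joint_law_def by (rule measurable_fst)
  show "integrable (joint_law \<pi> :: ('t \<times> 'a) measure) (\<lambda>\<omega>. w (fst \<omega>))"
    using integrable_distr[OF fst, of w] by (simp add: distr_joint_fst)
  show "(\<integral>\<omega>. w (fst \<omega>) \<partial>(joint_law \<pi> :: ('t \<times> 'a) measure)) = (\<integral>t. w t \<partial>\<pi>)"
    using integral_distr[OF fst, of w] by (simp add: distr_joint_fst)
qed

lemma integrable_joint_norm_snd: "integrable (joint_law \<pi>) (\<lambda>\<omega>. norm (snd \<omega> :: 'a))"
proof -
  have "integrable (\<pi> \<Otimes>\<^sub>M gaussian (0::'a) 1) (\<lambda>\<omega>. norm (snd \<omega>))"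
    by (intro prior_noise.Fubini_integrable) (auto simp: integrable_gaussian_norm)
  then show ?thesis
    by (simp add: joint_law_def)
qed

text \<open>Growth at most linear in the noise suffices because the norm of the noise has finite
  mean. This covers inner products with the noise, which are unbounded.\<close>

lemma integrable_joint_linear_bound:
  fixes f :: "'t \<times> 'a \<Rightarrow> real"
  assumes "f \<in> borel_measurable (joint_law \<pi>)"
    and bound: "\<And>t z. t \<in> T \<Longrightarrow> \<bar>f (t, z)\<bar> \<le> K * norm z"
  shows "integrable (joint_law \<pi>) f"
proof (rule Bochner_Integration.integrable_bound)
  show "integrable (joint_law \<pi> :: ('t \<times> 'a) measure) (\<lambda>\<omega>. K * norm (snd \<omega>))"
    using integrable_joint_norm_snd by simp
  show "AE \<omega> in joint_law \<pi>. norm (f \<omega>) \<le> norm (K * norm (snd \<omega>))"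
  proof (rule AE_I2)
    fix \<omega> :: "'t \<times> 'a"
    assume "\<omega> \<in> space (joint_law \<pi>)"
    then show "norm (f \<omega>) \<le> norm (K * norm (snd \<omega>))"
      using bound[of "fst \<omega>" "snd \<omega>"] by (cases \<omega>) simp
  qed
qed (fact assms(1))

text \<open>The direction \<open>w t\<close> depends on the parameter only, which is independent of
  the noise. Integrating over z first, with t fixed, gives zero.\<close>

lemma integral_joint_inner:
  fixes w :: "'t \<Rightarrow> 'a"
  shows "integrable (joint_law \<pi>) (\<lambda>(t, z). z \<bullet> w t)"
    and "(\<integral>\<omega>. (case \<omega> of (t, z) \<Rightarrow> z \<bullet> w t) \<partial>joint_law \<pi>) = 0"
proof -
  show int: "integrable (joint_law \<pi>) (\<lambda>(t, z). z \<bullet> w t)"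
  proof (rule integrable_joint_linear_bound)
    fix t and z :: 'a
    assume "t \<in> T"
    then have "norm (w t) \<le> Max ((\<lambda>t. norm (w t)) ` T)"
      using finite_T by simp
    then have "norm z * norm (w t) \<le> norm z * Max ((\<lambda>t. norm (w t)) ` T)"
      by (intro mult_left_mono) auto
    then show "\<bar>case (t, z) of (t, z) \<Rightarrow> z \<bullet> w t\<bar> \<le> Max ((\<lambda>t. norm (w t)) ` T) * norm z"
      using Cauchy_Schwarz_ineq2[of z "w t"] by (simp add: mult.commute)
  qed measurable
  then show "(\<integral>\<omega>. (case \<omega> of (t, z) \<Rightarrow> z \<bullet> w t) \<partial>joint_law \<pi>) = 0"
    unfolding joint_law_def
    by (subst prior_noise.integral_fst'[symmetric]) (simp_all add: integral_gaussian_inner)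
qed

lemma AE_joint_sample:
  assumes "\<And>t z. t \<in> T \<Longrightarrow> P t z"
  shows "AE (t, z) in (joint_law \<pi> :: ('t \<times> 'a) measure). P t z"
  using assms by (intro AE_I2) auto

lemma measurable_estimate [measurable]:
  assumes "estimator T est"
  shows "(\<lambda>\<omega>. v (est (obs v \<tau> (fst \<omega>) (snd \<omega>)))) \<in> borel_measurable (joint_law \<pi>)"
proof -
  have [measurable]: "est \<in> borel \<rightarrow>\<^sub>M count_space T"
    using assms by (simp add: estimator_def)
  show ?thesis
    unfolding obs_def by measurable
qed

lemma estimator_in: "estimator T est \<Longrightarrow> est y \<in> T"
  unfolding estimator_def by (auto dest: measurable_space)

lemma measurable_est_error [measurable]:
  assumes "estimator T est"
  shows "est_error v \<tau> est \<in> borel_measurable (joint_law \<pi>)"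
proof -
  note measurable_estimate[OF assms, measurable]
  have "est_error v \<tau> est = (\<lambda>\<omega>. norm (v (fst \<omega>) - v (est (obs v \<tau> (fst \<omega>) (snd \<omega>)))))"
    by (auto simp: est_error_def emb_dist_def)
  then show ?thesis
    by simp
qed

lemma measurable_process_gain [measurable]:
  assumes "estimator T est"
  shows "process_gain v \<tau> est \<in> borel_measurable (joint_law \<pi>)"
proof -
  note measurable_estimate[OF assms, measurable]
  have "process_gain v \<tau> est =
      (\<lambda>\<omega>. snd \<omega> \<bullet> v (est (obs v \<tau> (fst \<omega>) (snd \<omega>))) - snd \<omega> \<bullet> v (fst \<omega>))"
    by (auto simp: process_gain_def)
  then show ?thesis
    by simp
qed

lemma norm_embedding_diff_le:
  assumes "s \<in> T" "t \<in> T"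
  shows "norm (v s - v t) \<le> 2 * Max ((\<lambda>t. norm (v t)) ` T)"
proof -
  have "norm (v s) \<le> Max ((\<lambda>t. norm (v t)) ` T)" "norm (v t) \<le> Max ((\<lambda>t. norm (v t)) ` T)"
    using assms finite_T by simp_all
  then show ?thesis
    using norm_triangle_ineq4[of "v s" "v t"] by linarith
qed

lemma est_error_le:
  assumes "estimator T est" "t \<in> T"
  shows "est_error v \<tau> est (t, z) \<le> 2 * Max ((\<lambda>t. norm (v t)) ` T)"
  using norm_embedding_diff_le[OF assms(2) estimator_in[OF assms(1)]]
  by (simp add: est_error_def emb_dist_def)

lemma est_error_nonneg: "est_error v \<tau> est \<omega> \<ge> 0"
  by (simp add: est_error_def emb_dist_def split: prod.split)

text \<open>The error is at most twice the largest norm of an embedded point. The second moment is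
  there for the variance argument in the process bound.\<close>

lemma integrable_est_error:
  assumes "estimator T est"
  shows "integrable (joint_law \<pi>) (est_error v \<tau> est)"
    and "integrable (joint_law \<pi>) (\<lambda>\<omega>. (est_error v \<tau> est \<omega>)\<^sup>2)"
proof -
  note measurable_est_error[OF assms, measurable]
  show "integrable (joint_law \<pi>) (est_error v \<tau> est)"
    using est_error_le[OF assms] est_error_nonneg
    by (intro joint.integrable_const_bound[where B = "2 * Max ((\<lambda>t. norm (v t)) ` T)"] AE_I2) auto
  show "integrable (joint_law \<pi>) (\<lambda>\<omega>. (est_error v \<tau> est \<omega>)\<^sup>2)"
  proof (rule joint.integrable_const_bound)
    show "AE \<omega> in joint_law \<pi>. norm ((est_error v \<tau> est \<omega>)\<^sup>2) \<le> (2 * Max ((\<lambda>t. norm (v t)) ` T))\<^sup>2"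
    proof (rule AE_I2)
      fix \<omega> :: "'t \<times> 'a"
      assume "\<omega> \<in> space (joint_law \<pi>)"
      then have "est_error v \<tau> est \<omega> \<le> 2 * Max ((\<lambda>t. norm (v t)) ` T)"
        using est_error_le[OF assms] by (cases \<omega>) simp
      from power_mono[OF this est_error_nonneg, of 2]
      show "norm ((est_error v \<tau> est \<omega>)\<^sup>2) \<le> (2 * Max ((\<lambda>t. norm (v t)) ` T))\<^sup>2"
        by simp
    qed
  qed measurable
qed

lemma integrable_process_gain:
  assumes "estimator T est"
  shows "integrable (joint_law \<pi>) (process_gain v \<tau> est)"
proof (rule integrable_joint_linear_bound)
  show "process_gain v \<tau> est \<in> borel_measurable (joint_law \<pi>)"
    by (rule measurable_process_gain[OF assms])
  fix t and z :: 'a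
  assume t: "t \<in> T"
  let ?e = "est (obs v \<tau> t z)"
  have "\<bar>process_gain v \<tau> est (t, z)\<bar> = \<bar>z \<bullet> (v ?e - v t)\<bar>"
    by (simp add: process_gain_def inner_diff_right)
  also have "\<dots> \<le> norm z * norm (v ?e - v t)"
    by (rule Cauchy_Schwarz_ineq2)
  also have "\<dots> \<le> norm z * (2 * Max ((\<lambda>t. norm (v t)) ` T))"
    using norm_embedding_diff_le[OF estimator_in[OF assms] t] by (intro mult_left_mono) auto
  finally show "\<bar>process_gain v \<tau> est (t, z)\<bar> \<le> 2 * Max ((\<lambda>t. norm (v t)) ` T) * norm z"
    by (simp add: mult.commute)
qed

text \<open>The mean squared distance between two independent draws from the prior is twice the
  variance about the barycenter, which turns the factor 2 in \<open>info\<close> into 4.\<close>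

lemma info_barycenter: "info v \<tau> \<pi> (barycenter v \<pi>) = pair_variance v \<pi> / (4 * \<tau>\<^sup>2)"
proof -
  let ?b = "barycenter v \<pi>" and ?S = "\<integral>t. (norm (v t))\<^sup>2 \<partial>\<pi>"
  have mean: "(\<integral>t. u \<bullet> v t \<partial>\<pi>) = u \<bullet> ?b" for u
    unfolding barycenter_def by (rule integral_inner_right[OF integrable_prior])
  have prob: "measure \<pi> T = 1"
    using prior.prob_space unfolding space_prior .
  have expand: "(norm (x - y))\<^sup>2 = (norm x)\<^sup>2 + (norm y)\<^sup>2 - 2 * (x \<bullet> y)" for x y :: 'a
    by (simp add: power2_norm_eq_inner inner_diff_left inner_diff_right inner_commute[of y x])
  have sq: "(\<integral>t. (norm (u - v t))\<^sup>2 \<partial>\<pi>) = (norm u)\<^sup>2 + ?S - 2 * (u \<bullet> ?b)" for u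
    unfolding expand by (simp add: mean prob)
  \<comment> \<open>The inner integral is evaluated by \<open>sq\<close> with u =
    \<open>v s\<close>; integrating over s then uses \<open>mean\<close> once more.\<close>
  have "pair_variance v \<pi> = (\<integral>s. (norm (v s))\<^sup>2 + ?S - 2 * (?b \<bullet> v s) \<partial>\<pi>)"
    unfolding pair_variance_def emb_dist_def sq by (simp only: inner_commute)
  also have "\<dots> = 2 * (?S - (norm ?b)\<^sup>2)"
    by (simp add: mean prob power2_norm_eq_inner)
  also have "?S - (norm ?b)\<^sup>2 = (\<integral>t. (norm (v t - ?b))\<^sup>2 \<partial>\<pi>)"
    using sq[of ?b] by (simp add: norm_minus_commute power2_norm_eq_inner)
  finally show ?thesis
    by (simp add: info_def)
qed

section \<open>The error bound: change of measure and the hit probability\<close>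

text \<open>Passes from the reference law, where the observation is independent of the parameter, to
  the true experiment. For each t the Gaussian is recentered at \<open>v t\<close>, and the weight
  is the inverse likelihood ratio exp(-L).\<close>

lemma nn_integral_change_center:
  fixes F :: "'t \<Rightarrow> 'a \<Rightarrow> ennreal"
  assumes [measurable]: "case_prod F \<in> borel_measurable (count_space T \<Otimes>\<^sub>M borel)"
  shows "(\<integral>\<^sup>+\<omega>. case_prod F \<omega> \<partial>(\<pi> \<Otimes>\<^sub>M gaussian m \<tau>)) =
    (\<integral>\<^sup>+(t, z). F t (obs v \<tau> t z) *
      ennreal (exp (- ((norm (v t - m))\<^sup>2 + 2 * \<tau> * ((v t - m) \<bullet> z)) / (2 * \<tau>\<^sup>2))) \<partial>joint_law \<pi>)"
proof -
  interpret shifted: prob_space "gaussian m \<tau>"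
    by (rule prob_space_gaussian[OF noise_pos])
  have meas [measurable]: "F t \<in> borel_measurable borel" if "t \<in> T" for t
    using measurable_Pair2[OF assms, of t] that by simp
  have obs [measurable]: "(\<lambda>(t, z). F t (obs v \<tau> t z)) \<in> borel_measurable (count_space T \<Otimes>\<^sub>M borel)"
  proof -
    have "(\<lambda>(t, z). (t, obs v \<tau> t z)) \<in> count_space T \<Otimes>\<^sub>M borel \<rightarrow>\<^sub>M count_space T \<Otimes>\<^sub>M borel"
      unfolding obs_def by measurable
    from measurable_compose[OF this assms] show ?thesis
      by (simp add: case_prod_beta')
  qed
  have "(\<integral>\<^sup>+\<omega>. case_prod F \<omega> \<partial>(\<pi> \<Otimes>\<^sub>M gaussian m \<tau>)) = (\<integral>\<^sup>+t. (\<integral>\<^sup>+y. F t y \<partial>gaussian m \<tau>) \<partial>\<pi>)"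
    by (subst shifted.nn_integral_fst[symmetric]) simp_all
  also have "\<dots> = (\<integral>\<^sup>+t. (\<integral>\<^sup>+z. F t (obs v \<tau> t z) *
      ennreal (exp (- ((norm (v t - m))\<^sup>2 + 2 * \<tau> * ((v t - m) \<bullet> z)) / (2 * \<tau>\<^sup>2)))
        \<partial>gaussian 0 1) \<partial>\<pi>)"
    unfolding obs_def using noise_pos
    by (intro nn_integral_cong nn_integral_gaussian_shift) auto
  also have "\<dots> = (\<integral>\<^sup>+(t, z). F t (obs v \<tau> t z) *
      ennreal (exp (- ((norm (v t - m))\<^sup>2 + 2 * \<tau> * ((v t - m) \<bullet> z)) / (2 * \<tau>\<^sup>2))) \<partial>joint_law \<pi>)"
    unfolding joint_law_def by (subst noise.nn_integral_fst[symmetric]) simp_all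
  finally show ?thesis .
qed

text \<open>Keeping \<open>a\<close> free, rather than equal to log (1 / \<rho>), treats a vanishing
  \<rho> uniformly: every \<open>a\<close> is then admissible.\<close>

lemma prob_hit_le_info:
  fixes a \<Delta> :: real and m :: 'a
  assumes est: "estimator T est"
    and a: "exp a * rho v \<pi> \<Delta> (gaussian m \<tau>) est \<le> 1"
  shows "a * measure (joint_law \<pi>) {\<omega> \<in> space (joint_law \<pi>). est_error v \<tau> est \<omega> < \<Delta>}
    \<le> info v \<tau> \<pi> m + ln 2"
proof -
  note measurable_est_error[OF est, measurable]
  have [measurable]: "est \<in> borel \<rightarrow>\<^sub>M count_space T"
    using est by (simp add: estimator_def)
  interpret shifted: prob_space "gaussian m \<tau>"
    by (rule prob_space_gaussian[OF noise_pos])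
  interpret ref: pair_prob_space \<pi> "gaussian m \<tau>" ..
  \<comment> \<open>\<open>H\<close> and \<open>R\<close> describe the same hit event, first in the
    coordinates (t, z) of the true experiment, then in the coordinates (t, y) of the reference
    law.\<close>
  define H where "H = {\<omega> \<in> space (joint_law \<pi>). est_error v \<tau> est \<omega> < \<Delta>}"
  define R where "R = {(t, y) \<in> space (\<pi> \<Otimes>\<^sub>M gaussian m \<tau>). emb_dist v t (est y) < \<Delta>}"
  define L where "L = (\<lambda>(t, z). ((norm (v t - m))\<^sup>2 + 2 * \<tau> * ((v t - m) \<bullet> z)) / (2 * \<tau>\<^sup>2))"
  define h where "h \<omega> = a * indicator H \<omega> - L \<omega> - ln 2" for \<omega>
  have H [measurable]: "H \<in> sets (joint_law \<pi>)"
    unfolding H_def by measurable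
  have R_sets: "R \<in> sets (count_space T \<Otimes>\<^sub>M borel)"
  proof -
    have "R = {\<omega> \<in> space (count_space T \<Otimes>\<^sub>M borel). norm (v (fst \<omega>) - v (est (snd \<omega>))) < \<Delta>}"
      by (auto simp: R_def emb_dist_def space_pair_measure)
    also have "\<dots> \<in> sets (count_space T \<Otimes>\<^sub>M borel)"
      by measurable
    finally show ?thesis .
  qed
  then have R [measurable]: "R \<in> sets (\<pi> \<Otimes>\<^sub>M gaussian m \<tau>)"
    using sets_pair_measure_cong[of \<pi> "count_space T" "gaussian m \<tau>" borel]
    by (simp add: sets_prior)
  \<comment> \<open>The first summand depends on the parameter only and has mean
    \<open>info\<close>; the second is linear in the noise and has mean zero.\<close>
  have L_eq: "L \<omega> = (norm (v (fst \<omega>) - m))\<^sup>2 / (2 * \<tau>\<^sup>2) +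
      (case \<omega> of (t, z) \<Rightarrow> z \<bullet> ((1 / \<tau>) *\<^sub>R (v t - m)))" for \<omega>
  proof -
    have "(v t - m) \<bullet> z = \<tau> * (z \<bullet> ((1 / \<tau>) *\<^sub>R (v t - m)))" for t and z :: 'a
      using noise_pos by (simp add: inner_commute del: scaleR_right_diff_distrib)
    then show ?thesis
      using noise_pos by (cases \<omega>) (simp add: L_def add_divide_distrib power2_eq_square del: inner_scaleR_right)
  qed
  have int_L: "integrable (joint_law \<pi>) L"
    unfolding L_eq[abs_def]
    by (intro Bochner_Integration.integrable_add integral_joint_fst(1) integral_joint_inner(1))
  have "(\<integral>\<omega>. L \<omega> \<partial>joint_law \<pi>) = (\<integral>t. (norm (v t - m))\<^sup>2 / (2 * \<tau>\<^sup>2) \<partial>\<pi>) + 0"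
    unfolding L_eq[abs_def]
    using integral_joint_fst[of "\<lambda>t. (norm (v t - m))\<^sup>2 / (2 * \<tau>\<^sup>2)"]
    by (subst Bochner_Integration.integral_add) (simp_all only: integral_joint_inner)
  then have E_L: "(\<integral>\<omega>. L \<omega> \<partial>joint_law \<pi>) = info v \<tau> \<pi> m"
    by (simp add: info_def)
  have int_h: "integrable (joint_law \<pi>) h"
    unfolding h_def[abs_def] using int_L joint.emeasure_finite
    by (intro Bochner_Integration.integrable_diff) (auto simp: less_top[symmetric])
  have E_h: "(\<integral>\<omega>. h \<omega> \<partial>joint_law \<pi>) = a * measure (joint_law \<pi>) H - info v \<tau> \<pi> m - ln 2"
  proof -
    have "integrable (joint_law \<pi>) (\<lambda>\<omega>. a * indicator H \<omega> :: real)"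
      using joint.emeasure_finite by (auto simp: less_top[symmetric])
    moreover have "(\<integral>\<omega>. a * indicator H \<omega> \<partial>joint_law \<pi>) = a * measure (joint_law \<pi>) H"
      using sets.sets_into_space[OF H] by (simp add: Int_absorb2)
    ultimately show ?thesis
      using int_L joint.prob_space unfolding h_def[abs_def] by (simp add: E_L)
  qed
  \<comment> \<open>The division by 2 is exp(- ln 2); the remaining factor exp(-L) of exp(h) is the
    weight of the change of center.\<close>
  let ?F = "\<lambda>t y. ennreal (exp (a * indicator R (t, y)) / 2)"
  have F_meas: "case_prod ?F \<in> borel_measurable (count_space T \<Otimes>\<^sub>M borel)"
    using R_sets by (simp add: case_prod_beta')
  have "(\<integral>\<^sup>+\<omega>. ennreal (exp (h \<omega>)) \<partial>joint_law \<pi>) =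
      (\<integral>\<^sup>+(t, z). ?F t (obs v \<tau> t z) *
        ennreal (exp (- ((norm (v t - m))\<^sup>2 + 2 * \<tau> * ((v t - m) \<bullet> z)) / (2 * \<tau>\<^sup>2))) \<partial>joint_law \<pi>)"
  proof (intro nn_integral_cong)
    fix \<omega> :: "'t \<times> 'a"
    assume "\<omega> \<in> space (joint_law \<pi>)"
    then obtain t z where \<omega>: "\<omega> = (t, z)" "t \<in> T"
      by (cases \<omega>) simp
    then have "indicator H \<omega> = (indicator R (t, obs v \<tau> t z) :: real)"
      by (simp add: H_def R_def est_error_def space_pair_measure split: split_indicator)
    then have "exp (h \<omega>) = exp (a * indicator R (t, obs v \<tau> t z)) / 2 * exp (- L (t, z))"
      by (simp add: h_def \<omega> exp_diff exp_minus exp_add field_simps)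
    then show "ennreal (exp (h \<omega>)) = (case \<omega> of (t, z) \<Rightarrow> ?F t (obs v \<tau> t z) *
        ennreal (exp (- ((norm (v t - m))\<^sup>2 + 2 * \<tau> * ((v t - m) \<bullet> z)) / (2 * \<tau>\<^sup>2))))"
      by (simp add: \<omega> L_def ennreal_mult[symmetric] minus_divide_left)
  qed
  also have "\<dots> = (\<integral>\<^sup>+\<omega>. case_prod ?F \<omega> \<partial>(\<pi> \<Otimes>\<^sub>M gaussian m \<tau>))"
    by (rule nn_integral_change_center[OF F_meas, symmetric])
  \<comment> \<open>Pointwise: off \<open>R\<close> both sides are 1/2, and on \<open>R\<close> the
    right side exceeds exp a / 2 by 1/2.\<close>
  also have "\<dots> \<le> (\<integral>\<^sup>+\<omega>. ennreal (1 / 2) + ennreal (exp a / 2) * indicator R \<omega> \<partial>(\<pi> \<Otimes>\<^sub>M gaussian m \<tau>))"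
    by (intro nn_integral_mono) (auto split: split_indicator simp: ennreal_plus[symmetric] simp del: ennreal_plus)
  also have "\<dots> = ennreal (1 / 2) + ennreal (exp a / 2) * emeasure (\<pi> \<Otimes>\<^sub>M gaussian m \<tau>) R"
    by (subst nn_integral_add) (simp_all add: nn_integral_cmult_indicator[OF R] ref.emeasure_space_1)
  also have "\<dots> = ennreal (1 / 2 + exp a / 2 * rho v \<pi> \<Delta> (gaussian m \<tau>) est)"
    by (simp add: ref.emeasure_eq_measure rho_def R_def[symmetric] ennreal_mult[symmetric])
  also have "\<dots> \<le> ennreal 1"
    using a by (intro ennreal_leI) simp
  finally have nn: "(\<integral>\<^sup>+\<omega>. ennreal (exp (h \<omega>)) \<partial>joint_law \<pi>) \<le> ennreal 1" .
  have h_meas [measurable]: "h \<in> borel_measurable (joint_law \<pi>)"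
    using int_h by (rule borel_measurable_integrable)
  have int_exp: "integrable (joint_law \<pi>) (\<lambda>\<omega>. exp (h \<omega>))"
    using nn by (intro integrableI_nonneg) (auto intro: le_less_trans)
  then have "(\<integral>\<omega>. exp (h \<omega>) \<partial>joint_law \<pi>) \<le> 1"
    using nn by (simp add: nn_integral_eq_integral)
  \<comment> \<open>Together with the bound on the mean of exp(h), this makes the mean of
    \<open>h\<close> nonpositive, which is the claim by \<open>E_h\<close>.\<close>
  moreover have "(\<integral>\<omega>. 1 + h \<omega> \<partial>joint_law \<pi>) \<le> (\<integral>\<omega>. exp (h \<omega>) \<partial>joint_law \<pi>)"
    using int_h int_exp by (intro integral_mono) (auto simp: exp_ge_add_one_self)
  moreover have "(\<integral>\<omega>. 1 + h \<omega> \<partial>joint_law \<pi>) = 1 + (\<integral>\<omega>. h \<omega> \<partial>joint_law \<pi>)"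
    using int_h joint.prob_space by simp
  ultimately show ?thesis
    using E_h by (simp add: H_def)
qed

lemma info_nonneg: "info v \<tau> \<pi> m \<ge> 0"
  unfolding info_def by (intro mult_nonneg_nonneg integral_nonneg_AE) auto

text \<open>The hit probability is at most 1 - c, so the error reaches \<Delta> with probability at
  least c, and Markov's inequality at level \<Delta> finishes.\<close>

lemma expected_error_ge:
  assumes est: "estimator T est" and c: "c < 1" and \<Delta>: "0 < \<Delta>"
    and fano: "ereal (info v \<tau> \<pi> m + ln 2)
      \<le> ereal (1 - c) * log_recip (rho v \<pi> \<Delta> (gaussian m \<tau>) est)"
  shows "c * \<Delta> \<le> (\<integral>\<omega>. est_error v \<tau> est \<omega> \<partial>joint_law \<pi>)"
proof -
  note measurable_est_error[OF est, measurable]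
  let ?\<rho> = "rho v \<pi> \<Delta> (gaussian m \<tau>) est"
  let ?err = "est_error v \<tau> est"
  define K where "K = info v \<tau> \<pi> m + ln 2"
  define p where "p = measure (joint_law \<pi>) {\<omega> \<in> space (joint_law \<pi>). ?err \<omega> < \<Delta>}"
  \<comment> \<open>The summand ln 2 makes \<open>K\<close> strictly positive, so it can be
    cancelled when bounding \<open>p\<close>.\<close>
  have K: "K > 0"
    using info_nonneg[of m] by (simp add: K_def add_nonneg_pos)
  have "exp (K / (1 - c)) * ?\<rho> \<le> 1"
  proof (cases "?\<rho> = 0")
    case False
    then have \<rho>: "?\<rho> > 0"
      by (simp add: rho_def zero_less_measure_iff measure_nonneg less_le)
    have "K \<le> (1 - c) * ln (1 / ?\<rho>)"
      using fano False by (simp add: log_recip_def K_def)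
    then have "K / (1 - c) \<le> ln (1 / ?\<rho>)"
      using c by (simp add: field_simps)
    then have "exp (K / (1 - c)) \<le> 1 / ?\<rho>"
      using \<rho> by (simp add: ln_ge_iff)
    then show ?thesis
      using \<rho> by (simp add: field_simps)
  qed simp
  from prob_hit_le_info[OF est this] have "K / (1 - c) * p \<le> K"
    by (simp add: K_def p_def)
  then have "K * p \<le> K * (1 - c)"
    using c by (simp add: field_simps)
  then have p: "p \<le> 1 - c"
    using K by (simp only: mult_le_cancel_left_pos)
  have "1 - p = measure (joint_law \<pi>) {\<omega> \<in> space (joint_law \<pi>). \<not> ?err \<omega> < \<Delta>}"
    unfolding p_def by (intro joint.prob_neg[symmetric]) measurable
  also have "\<dots> = measure (joint_law \<pi>) {\<omega> \<in> space (joint_law \<pi>). \<Delta> \<le> ?err \<omega>}"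
    by (simp add: not_less)
  also have "\<dots> \<le> (\<integral>\<omega>. ?err \<omega> \<partial>joint_law \<pi>) / \<Delta>"
    using integrable_est_error(1)[OF est] \<Delta> est_error_nonneg
    by (intro integral_Markov_inequality_measure[where A = "{}"]) auto
  finally show ?thesis
    using p \<Delta> mult_right_mono[of c "1 - p" \<Delta>] by (simp add: field_simps)
qed

section \<open>From estimation error to gain of the Gaussian process\<close>

text \<open>The lower bound on the penalty at the estimate removes \<Omega> from the comparison of
  residuals. Since the true residual is \<tau> z, the difference of squared residuals is the squared
  error minus 2 \<tau> times the gain.\<close>

lemma AE_error_le_gain:
  assumes "comparison_condition v \<tau> \<pi> est \<Omega> \<epsilon>\<^sub>o\<^sub>p\<^sub>t \<epsilon>\<^sub>p\<^sub>e\<^sub>n"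
  shows "AE \<omega> in joint_law \<pi>. (est_error v \<tau> est \<omega>)\<^sup>2 - (\<epsilon>\<^sub>o\<^sub>p\<^sub>t \<omega> + \<epsilon>\<^sub>p\<^sub>e\<^sub>n \<omega>) \<le> 2 * \<tau> * process_gain v \<tau> est \<omega>"
proof -
  have "AE (\<theta>, z) in joint_law \<pi>.
        (norm (obs v \<tau> \<theta> z - v (est (obs v \<tau> \<theta> z))))\<^sup>2 + \<Omega> (est (obs v \<tau> \<theta> z))
          \<le> (norm (obs v \<tau> \<theta> z - v \<theta>))\<^sup>2 + \<Omega> \<theta> + \<epsilon>\<^sub>o\<^sub>p\<^sub>t (\<theta>, z)"
    and "AE (\<theta>, z) in joint_law \<pi>. \<Omega> (est (obs v \<tau> \<theta> z)) \<ge> \<Omega> \<theta> - \<epsilon>\<^sub>p\<^sub>e\<^sub>n (\<theta>, z)"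
    using assms by (simp_all add: comparison_condition_def)
  then show ?thesis
  proof eventually_elim
    case (elim \<omega>)
    obtain \<theta> z where \<omega>: "\<omega> = (\<theta>, z)"
      by (cases \<omega>)
    let ?e = "v (est (obs v \<tau> \<theta> z))"
    have "(norm (obs v \<tau> \<theta> z - ?e))\<^sup>2 - (norm (obs v \<tau> \<theta> z - v \<theta>))\<^sup>2 =
        (norm (v \<theta> - ?e))\<^sup>2 - 2 * \<tau> * (z \<bullet> ?e - z \<bullet> v \<theta>)"
    proof -
      have "(norm (u + \<tau> *\<^sub>R z))\<^sup>2 - (norm (\<tau> *\<^sub>R z))\<^sup>2 = (norm u)\<^sup>2 + 2 * \<tau> * (z \<bullet> u)" for u
        unfolding power2_norm_eq_inner
        by (simp add: inner_add_left inner_add_right inner_commute[of u z] algebra_simps)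
      \<comment> \<open>The residual at the estimate is u + \<tau> z with u =
        \<open>v \<theta> - ?e\<close>.\<close>
      from this[of "v \<theta> - ?e"] show ?thesis
        by (simp add: obs_def inner_diff_right algebra_simps)
    qed
    with elim show ?case
      by (simp add: \<omega> est_error_def emb_dist_def process_gain_def)
  qed
qed

lemma expected_gain_ge:
  assumes est: "estimator T est"
    and comp: "comparison_condition v \<tau> \<pi> est \<Omega> \<epsilon>\<^sub>o\<^sub>p\<^sub>t \<epsilon>\<^sub>p\<^sub>e\<^sub>n"
    and b: "0 \<le> b" "b \<le> (\<integral>\<omega>. est_error v \<tau> est \<omega> \<partial>joint_law \<pi>)"
  shows "(b\<^sup>2 - (\<integral>\<omega>. (\<epsilon>\<^sub>o\<^sub>p\<^sub>t \<omega> + \<epsilon>\<^sub>p\<^sub>e\<^sub>n \<omega>) \<partial>joint_law \<pi>)) / (2 * \<tau>)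
    \<le> (\<integral>\<omega>. process_gain v \<tau> est \<omega> \<partial>joint_law \<pi>)"
proof -
  note int_err = integrable_est_error[OF est]
  have int_eps: "integrable (joint_law \<pi>) (\<lambda>\<omega>. \<epsilon>\<^sub>o\<^sub>p\<^sub>t \<omega> + \<epsilon>\<^sub>p\<^sub>e\<^sub>n \<omega>)"
    using comp by (intro Bochner_Integration.integrable_add) (simp_all add: comparison_condition_def)
  have "b\<^sup>2 \<le> (\<integral>\<omega>. est_error v \<tau> est \<omega> \<partial>joint_law \<pi>)\<^sup>2"
    using b by (intro power_mono) auto
  \<comment> \<open>Jensen's inequality for the square, in the form that the variance is
    nonnegative.\<close>
  also have "\<dots> \<le> (\<integral>\<omega>. (est_error v \<tau> est \<omega>)\<^sup>2 \<partial>joint_law \<pi>)"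
    using joint.variance_positive[of "est_error v \<tau> est"] joint.variance_eq[OF int_err] by simp
  finally have "b\<^sup>2 - (\<integral>\<omega>. (\<epsilon>\<^sub>o\<^sub>p\<^sub>t \<omega> + \<epsilon>\<^sub>p\<^sub>e\<^sub>n \<omega>) \<partial>joint_law \<pi>)
      \<le> (\<integral>\<omega>. (est_error v \<tau> est \<omega>)\<^sup>2 - (\<epsilon>\<^sub>o\<^sub>p\<^sub>t \<omega> + \<epsilon>\<^sub>p\<^sub>e\<^sub>n \<omega>) \<partial>joint_law \<pi>)"
    using int_err(2) int_eps by (subst Bochner_Integration.integral_diff) simp_all
  also have "\<dots> \<le> (\<integral>\<omega>. 2 * \<tau> * process_gain v \<tau> est \<omega> \<partial>joint_law \<pi>)"
    using AE_error_le_gain[OF comp] int_err(2) int_eps integrable_process_gain[OF est]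
    by (intro integral_mono_AE Bochner_Integration.integrable_diff integrable_mult_right)
  finally show ?thesis
    using noise_pos by (simp add: field_simps)
qed

section \<open>Decoders that satisfy the comparison condition, and the combined result\<close>

text \<open>Minimality is tested against the true parameter, which lies in \<open>T\<close>. The
  case \<Omega> = 0 is the nearest-neighbor decoder, and a multiple of the squared norm gives the
  norm-regularized rule.\<close>

lemma penalized_least_squares_comparison:
  fixes est :: "'a \<Rightarrow> 't"
  assumes "\<And>y. is_arg_min (\<lambda>a. (norm (y - v a))\<^sup>2 + \<Omega> a) (\<lambda>a. a \<in> T) (est y)"
    and "AE (\<theta>, z) in joint_law \<pi>. \<Omega> \<theta> \<le> \<Omega> (est (obs v \<tau> \<theta> z))"
  shows "comparison_condition v \<tau> \<pi> est \<Omega> (\<lambda>_. 0) (\<lambda>_. 0)"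
proof -
  have "AE (\<theta>, z) in joint_law \<pi>.
      (norm (obs v \<tau> \<theta> z - v (est (obs v \<tau> \<theta> z))))\<^sup>2 + \<Omega> (est (obs v \<tau> \<theta> z))
        \<le> (norm (obs v \<tau> \<theta> z - v \<theta>))\<^sup>2 + \<Omega> \<theta>"
    using assms(1) by (intro AE_joint_sample) (auto simp: is_arg_min_linorder)
  then show ?thesis
    using assms(2) by (simp add: comparison_condition_def)
qed

end

theorem theorem1p5:
  fixes T :: "'t set"
    and v :: "'t \<Rightarrow> 'a::euclidean_space"
    and \<pi> :: "'t measure"
    and \<tau> :: real
    and m :: 'a
  assumes "finite T"
    and "inj_on v T"
    and "prob_space \<pi>"
    and "sets \<pi> = Pow T"
    and "\<tau> > 0"
  shows
    "(\<forall>(est :: 'a \<Rightarrow> 't) (\<Omega> :: 't \<Rightarrow> real) (\<epsilon>\<^sub>o\<^sub>p\<^sub>t :: 't \<times> 'a \<Rightarrow> real)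
        (\<epsilon>\<^sub>p\<^sub>e\<^sub>n :: 't \<times> 'a \<Rightarrow> real) (c :: real) (\<Delta> :: real).
        estimator T est \<longrightarrow>
        comparison_condition v \<tau> \<pi> est \<Omega> \<epsilon>\<^sub>o\<^sub>p\<^sub>t \<epsilon>\<^sub>p\<^sub>e\<^sub>n \<longrightarrow>
        0 < c \<longrightarrow> c < 1 \<longrightarrow> 0 < \<Delta> \<longrightarrow>
        ereal (info v \<tau> \<pi> m + ln 2)
          \<le> ereal (1 - c) * log_recip (rho v \<pi> \<Delta> (gaussian m \<tau>) est) \<longrightarrow>
        (let E\<epsilon> = (\<integral>\<omega>. (\<epsilon>\<^sub>o\<^sub>p\<^sub>t \<omega> + \<epsilon>\<^sub>p\<^sub>e\<^sub>n \<omega>) \<partial>joint_law \<pi>);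
             bound = (c\<^sup>2 * \<Delta>\<^sup>2 - E\<epsilon>) / (2 * \<tau>)
         in integrable (joint_law \<pi>) (est_error v \<tau> est) \<and>
            (\<integral>\<omega>. est_error v \<tau> est \<omega> \<partial>joint_law \<pi>) \<ge> c * \<Delta> \<and>
            integrable (joint_law \<pi>) (process_gain v \<tau> est) \<and>
            (\<integral>\<omega>. process_gain v \<tau> est \<omega> \<partial>joint_law \<pi>) \<ge> bound \<and>
            (E\<epsilon> \<le> c\<^sup>2 * \<Delta>\<^sup>2 / 2 \<longrightarrow> bound \<ge> c\<^sup>2 * \<Delta>\<^sup>2 / (4 * \<tau>)))) \<and>
     info v \<tau> \<pi> (barycenter v \<pi>) = pair_variance v \<pi> / (4 * \<tau>\<^sup>2) \<and>
     (\<forall>est :: 'a \<Rightarrow> 't.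
        estimator T est \<longrightarrow>
        (\<forall>y. is_arg_min (\<lambda>a. (norm (y - v a))\<^sup>2) (\<lambda>a. a \<in> T) (est y)) \<longrightarrow>
        comparison_condition v \<tau> \<pi> est (\<lambda>_. 0) (\<lambda>_. 0) (\<lambda>_. 0)) \<and>
     (\<forall>(est :: 'a \<Rightarrow> 't) (\<kappa> :: real).
        estimator T est \<longrightarrow> 0 \<le> \<kappa> \<longrightarrow>
        (\<forall>y. is_arg_min (\<lambda>a. (norm (y - v a))\<^sup>2 + \<kappa> * (norm (v a))\<^sup>2) (\<lambda>a. a \<in> T) (est y)) \<longrightarrow>
        (AE (\<theta>, z) in joint_law \<pi>. norm (v (est (obs v \<tau> \<theta> z))) \<ge> norm (v \<theta>)) \<longrightarrow>
        comparison_condition v \<tau> \<pi> est (\<lambda>t. \<kappa> * (norm (v t))\<^sup>2) (\<lambda>_. 0) (\<lambda>_. 0))"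
    (is "?lower \<and> ?bary \<and> ?nearest \<and> ?ridge")
proof -
  interpret gaussian_location T v \<pi> \<tau>
    using assms by (intro gaussian_location.intro)
  have ?lower
  proof (intro allI impI)
    fix est :: "'a \<Rightarrow> 't" and \<Omega> :: "'t \<Rightarrow> real" and \<epsilon>\<^sub>o\<^sub>p\<^sub>t \<epsilon>\<^sub>p\<^sub>e\<^sub>n :: "'t \<times> 'a \<Rightarrow> real" and c \<Delta> :: real
    assume est: "estimator T est"
      and comp: "comparison_condition v \<tau> \<pi> est \<Omega> \<epsilon>\<^sub>o\<^sub>p\<^sub>t \<epsilon>\<^sub>p\<^sub>e\<^sub>n"
      and c: "0 < c" "c < 1" and \<Delta>: "0 < \<Delta>"
      and fano: "ereal (info v \<tau> \<pi> m + ln 2)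
        \<le> ereal (1 - c) * log_recip (rho v \<pi> \<Delta> (gaussian m \<tau>) est)"
    define E where "E = (\<integral>\<omega>. (\<epsilon>\<^sub>o\<^sub>p\<^sub>t \<omega> + \<epsilon>\<^sub>p\<^sub>e\<^sub>n \<omega>) \<partial>joint_law \<pi>)"
    have err: "c * \<Delta> \<le> (\<integral>\<omega>. est_error v \<tau> est \<omega> \<partial>joint_law \<pi>)"
      by (rule expected_error_ge[OF est c(2) \<Delta> fano])
    \<comment> \<open>The lower bound b on the mean error is taken to be c \<Delta>.\<close>
    moreover have "(c\<^sup>2 * \<Delta>\<^sup>2 - E) / (2 * \<tau>) \<le> (\<integral>\<omega>. process_gain v \<tau> est \<omega> \<partial>joint_law \<pi>)"
      using expected_gain_ge[OF est comp _ err] c \<Delta> by (simp add: E_def power_mult_distrib)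
    moreover have "c\<^sup>2 * \<Delta>\<^sup>2 / (4 * \<tau>) \<le> (c\<^sup>2 * \<Delta>\<^sup>2 - E) / (2 * \<tau>)" if "E \<le> c\<^sup>2 * \<Delta>\<^sup>2 / 2"
      using that noise_pos by (simp add: field_simps)
    ultimately show "let E\<epsilon> = (\<integral>\<omega>. (\<epsilon>\<^sub>o\<^sub>p\<^sub>t \<omega> + \<epsilon>\<^sub>p\<^sub>e\<^sub>n \<omega>) \<partial>joint_law \<pi>);
             bound = (c\<^sup>2 * \<Delta>\<^sup>2 - E\<epsilon>) / (2 * \<tau>)
         in integrable (joint_law \<pi>) (est_error v \<tau> est) \<and>
            (\<integral>\<omega>. est_error v \<tau> est \<omega> \<partial>joint_law \<pi>) \<ge> c * \<Delta> \<and>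
            integrable (joint_law \<pi>) (process_gain v \<tau> est) \<and>
            (\<integral>\<omega>. process_gain v \<tau> est \<omega> \<partial>joint_law \<pi>) \<ge> bound \<and>
            (E\<epsilon> \<le> c\<^sup>2 * \<Delta>\<^sup>2 / 2 \<longrightarrow> bound \<ge> c\<^sup>2 * \<Delta>\<^sup>2 / (4 * \<tau>))"
      using integrable_est_error(1)[OF est] integrable_process_gain[OF est]
      unfolding Let_def E_def[symmetric] by blast
  qed
  moreover have ?nearest
    using penalized_least_squares_comparison[of "\<lambda>_. 0"] by simp
  moreover have ?ridge
  proof (intro allI impI)
    fix est :: "'a \<Rightarrow> 't" and \<kappa> :: real
    assume \<kappa>: "0 \<le> \<kappa>"
      and min: "\<forall>y. is_arg_min (\<lambda>a. (norm (y - v a))\<^sup>2 + \<kappa> * (norm (v a))\<^sup>2) (\<lambda>a. a \<in> T) (est y)"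
      and AE: "AE (\<theta>, z) in joint_law \<pi>. norm (v (est (obs v \<tau> \<theta> z))) \<ge> norm (v \<theta>)"
    have "AE (\<theta>, z) in joint_law \<pi>. \<kappa> * (norm (v \<theta>))\<^sup>2 \<le> \<kappa> * (norm (v (est (obs v \<tau> \<theta> z))))\<^sup>2"
      using AE by eventually_elim (auto intro!: mult_left_mono power_mono \<kappa>)
    then show "comparison_condition v \<tau> \<pi> est (\<lambda>t. \<kappa> * (norm (v t))\<^sup>2) (\<lambda>_. 0) (\<lambda>_. 0)"
      using min by (intro penalized_least_squares_comparison) auto
  qed
  ultimately show ?thesis
    using info_barycenter by blast
qed

end
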